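(* Let $m\ge 1$ and let $\Gamma$ be a family of 1-regular digraphs, all having the same vertex set $V$, with $n=|V|$. Let $C_m^+$ be the directed cycle with vertex set $\{a_1,\dots,a_m\}$ and arcs $(a_i,a_{i+1})$, $1\le i\le m-1$, and $(a_m,a_1)$, and let $h:E(C_m^+)\to\Gamma$ be any function. Color $C_m^+$ with color sequence $(s_1,\dots,s_m)$ (arc $(a_i,a_{i+1})$ gets $s_i$, arc $(a_m,a_1)$ gets $s_m$), and give $M_h$ the induced arc coloring. Then $C_m^+\otimes_h\Gamma$ is strongly connected, that is, it is a strongly oriented cycle of length $mn$, if and only if $M_h$ is rainbow eulerian with color sequence $(s_1,s_2,\dots,s_m)$.
   Context: Product: for a digraph $D$, a family $\Gamma$ of digraphs all with vertex set $V$, and a function $h:E(D)\to\Gamma$, the digraph $D\otimes_h\Gamma$ has vertex set $V(D)\times V$, and $((a,x),(b,y))$ is an arc iff $(a,b)\in E(D)$ and $(x,y)\in E(h(a,b))$. For $h:E(C_m^+)\to\Gamma$, $M_h$ is the multidigraph with vertex set $V$ whose arc multiset is the union, with repetitions, of $E(h(e))$ over all $e\in E(C_m^+)$ (an arc $(x,y)$ lying in $h(e)$ for $r$ different arcs $e$ appears $r$ times). Induced coloring: each copy of an arc of $M_h$ coming from $h(e)$ receives the color of $e$. A circuit is a closed directed trail (no arc of the multidigraph used twice). For an arc-colored multidigraph with $l$ colors, a rainbow circuit with color sequence $(s_1,\dots,s_l)$ is a circuit whose consecutive arcs are colored $s_1,s_2,\dots,s_l,s_1,s_2,\dots$ cyclically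 (the sequence of $l$ colors repeats); the multidigraph is rainbow eulerian (with that color sequence) if it has an eulerian circuit that is such a rainbow circuit. A 1-regular digraph is one in which every vertex has in-degree and out-degree $1$. *)

theory Defs
  imports "Graph_Theory.Graph_Theory"
begin

text \<open>
  Digraphs (loops allowed, no parallel arcs) are values of type \<^typ>\<open>'a pair_pre_digraph\<close>,
  whose arcs are pairs of vertices; multidigraphs are values of type
  \<^typ>\<open>('a, 'b) pre_digraph\<close>.
\<close>

text \<open>The directed cycle on \<open>a 1, \<dots>, a m\<close>. It is meaningful for \<open>m \<ge> 1\<close> and \<open>a\<close> injective on
  \<open>{1..m}\<close>; for \<open>m = 1\<close> it is a single vertex with a loop.\<close>

definition dir_cycle :: "nat \<Rightarrow> (nat \<Rightarrow> 'a) \<Rightarrow> 'a pair_pre_digraph" where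
  "dir_cycle m a =
     \<lparr> pverts = a ` {1..m},
       parcs = {(a i, a (i + 1)) | i. 1 \<le> i \<and> i \<le> m - 1} \<union> {(a m, a 1)} \<rparr>"

definition strongly_oriented_cycle :: "'a pair_pre_digraph \<Rightarrow> nat \<Rightarrow> bool" where
  "strongly_oriented_cycle D k \<longleftrightarrow>
     k \<ge> 1 \<and> (\<exists>b. inj_on b {1..k} \<and> D = dir_cycle k b)"

definition one_regular :: "'a pair_pre_digraph \<Rightarrow> bool" where
  "one_regular D \<longleftrightarrow>
     (\<forall>v \<in> pverts D. in_degree (with_proj D) v = 1 \<and> out_degree (with_proj D) v = 1)"

text \<open>The common vertex set \<open>V\<close> of the family is a parameter, since it cannot be read off
  from \<open>h\<close> when \<open>D\<close> has no arcs.\<close>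

definition digraph_product ::
  "'a pair_pre_digraph \<Rightarrow> 'v set \<Rightarrow> ('a \<times> 'a \<Rightarrow> 'v pair_pre_digraph) \<Rightarrow> ('a \<times> 'v) pair_pre_digraph"
where
  "digraph_product D V h =
     \<lparr> pverts = pverts D \<times> V,
       parcs = {((a, x), (b, y)) | a x b y. (a, b) \<in> parcs D \<and> (x, y) \<in> parcs (h (a, b))} \<rparr>"

text \<open>The multidigraph \<open>M_h\<close>: the arc \<open>(e, (x, y))\<close> is the copy of \<open>(x, y)\<close> coming from \<open>h e\<close>,
  so that a pair lying in \<open>h e\<close> for \<open>r\<close> different \<open>e\<close> gives \<open>r\<close> parallel arcs.\<close>

definition union_multidigraph ::
  "'a pair_pre_digraph \<Rightarrow> 'v set \<Rightarrow> ('a \<times> 'a \<Rightarrow> 'v pair_pre_digraph)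
    \<Rightarrow> ('v, ('a \<times> 'a) \<times> ('v \<times> 'v)) pre_digraph"
where
  "union_multidigraph D V h =
     \<lparr> verts = V,
       arcs = {(e, (x, y)) | e x y. e \<in> parcs D \<and> (x, y) \<in> parcs (h e)},
       tail = (\<lambda>(e, (x, y)). x),
       head = (\<lambda>(e, (x, y)). y) \<rparr>"

definition induced_coloring ::
  "('a \<times> 'a \<Rightarrow> 'c) \<Rightarrow> ('a \<times> 'a) \<times> ('v \<times> 'v) \<Rightarrow> 'c"
where
  "induced_coloring col = (\<lambda>(e, xy). col e)"

text \<open>The colors along a rainbow circuit repeat \<open>s\<close> cyclically. As the last arc of a circuit is
  followed by the first one, the circuit consists of complete repetitions of \<open>s\<close>.\<close>

definition rainbow_circuit ::
  "('v, 'e) pre_digraph \<Rightarrow> ('e \<Rightarrow> 'c) \<Rightarrow> 'c list \<Rightarrow> 'v \<Rightarrow> 'e awalk \<Rightarrow> bool"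
where
  "rainbow_circuit G col s u p \<longleftrightarrow>
     pre_digraph.trail G u p u \<and> (\<exists>k. map col p = concat (replicate k s))"

definition rainbow_eulerian ::
  "('v, 'e) pre_digraph \<Rightarrow> ('e \<Rightarrow> 'c) \<Rightarrow> 'c list \<Rightarrow> bool"
where
  "rainbow_eulerian G col s \<longleftrightarrow>
     (\<exists>u p. pre_digraph.euler_trail G u p u \<and> rainbow_circuit G col s u p)"

end

theory Submission
  imports Defs
begin

text \<open>
  A strongly connected finite 1-regular digraph is traversed by a single periodic walk \<open>W\<close>. If
  \<open>W\<close> runs through \<open>C\<^sub>m\<^sup>+ \<otimes>\<^sub>h \<Gamma>\<close> and starts above \<open>a\<^sub>1\<close>, then its first coordinates are forced to
  run around the cycle, so the arcs \<open>((a\<^sub>i, x), (a\<^sub>i\<^sub>+\<^sub>1, y))\<close> of \<open>W\<close>, read as the copies of \<open>(x, y)\<close>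
  in \<open>M\<^sub>h\<close> coming from \<open>(a\<^sub>i, a\<^sub>i\<^sub>+\<^sub>1)\<close>, occur in rainbow order. A vertex of the product has exactly
  one outgoing arc, hence vertices of the product correspond to arcs of \<open>M\<^sub>h\<close>, and the closed walks
  through all the former are the rainbow eulerian circuits of the latter.
\<close>

section \<open>The directed cycle with periodic indexing\<close>

text \<open>The vertices of the directed cycle, indexed from 0 and continued periodically, so that the
  arc from \<open>a m\<close> to \<open>a 1\<close> needs no separate treatment.\<close>

definition cyc :: "nat \<Rightarrow> (nat \<Rightarrow> 'a) \<Rightarrow> nat \<Rightarrow> 'a" where
  "cyc m a i = a (Suc (i mod m))"

lemma cyc_eq_iff:
  assumes "m \<ge> 1" "inj_on a {1..m}"
  shows "cyc m a i = cyc m a j \<longleftrightarrow> i mod m = j mod m"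
proof -
  have "Suc (k mod m) \<in> {1..m}" for k
    using assms(1) by (simp add: Suc_le_eq)
  then show ?thesis
    unfolding cyc_def using inj_on_eq_iff[OF assms(2)] by (metis nat.inject)
qed

text \<open>An index read off from a vertex is known only modulo \<open>m\<close>; this still fixes
  the next vertex.\<close>

lemma cyc_Suc_cong: "i mod m = j mod m \<Longrightarrow> cyc m a (Suc i) = cyc m a (Suc j)"
  unfolding cyc_def by (simp add: mod_Suc)

lemma pverts_dir_cycle:
  assumes "m \<ge> 1"
  shows "pverts (dir_cycle m a) = range (cyc m a)"
proof -
  have "range (\<lambda>i. Suc (i mod m)) = {1..m}"
  proof (intro equalityI subsetI)
    fix j assume "j \<in> {1..m}"
    then have "j = Suc ((j - 1) mod m)" by auto
    then show "j \<in> range (\<lambda>i. Suc (i mod m))" by blast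
  qed (use assms in \<open>auto simp: Suc_le_eq\<close>)
  moreover have "range (cyc m a) = a ` range (\<lambda>i. Suc (i mod m))"
    unfolding cyc_def by auto
  ultimately show ?thesis by (simp add: dir_cycle_def)
qed

text \<open>Position \<open>i\<close> on the periodic walk has residue \<open>i mod m\<close>;
  residue \<open>m - 1\<close> yields the closing arc \<open>(a m, a 1)\<close>, every other residue
  an arc \<open>(a i, a (i + 1))\<close>.\<close>

lemma parcs_dir_cycle:
  assumes "m \<ge> 1"
  shows "parcs (dir_cycle m a) = range (\<lambda>i. (cyc m a i, cyc m a (Suc i)))"
proof (intro equalityI subsetI)
  fix e assume "e \<in> parcs (dir_cycle m a)"
  then consider i where "1 \<le> i" "i \<le> m - 1" "e = (a i, a (i + 1))" | "e = (a m, a 1)"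
    unfolding dir_cycle_def by auto
  then show "e \<in> range (\<lambda>i. (cyc m a i, cyc m a (Suc i)))"
  proof cases
    case 1
    then have "e = (cyc m a (i - 1), cyc m a (Suc (i - 1)))" by (auto simp: cyc_def)
    then show ?thesis by blast
  next
    case 2
    then have "e = (cyc m a (m - 1), cyc m a (Suc (m - 1)))" using assms by (auto simp: cyc_def)
    then show ?thesis by blast
  qed
next
  fix e assume "e \<in> range (\<lambda>i. (cyc m a i, cyc m a (Suc i)))"
  then obtain i where e: "e = (cyc m a i, cyc m a (Suc i))" by auto
  show "e \<in> parcs (dir_cycle m a)"
  proof (cases "Suc (i mod m) = m")
    case True
    then show ?thesis using e by (simp add: dir_cycle_def cyc_def mod_Suc)
  next
    case False
    moreover have "i mod m < m" using assms by simp
    ultimately have "Suc (i mod m) \<le> m - 1" by linarith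
    then show ?thesis using e False by (auto simp: dir_cycle_def cyc_def mod_Suc)
  qed
qed

lemma finite_pverts_dir_cycle: "finite (pverts (dir_cycle m a))"
  by (simp add: dir_cycle_def)

lemma card_pverts_dir_cycle: "inj_on a {1..m} \<Longrightarrow> card (pverts (dir_cycle m a)) = m"
  by (simp add: dir_cycle_def card_image)

lemma pair_wf_dir_cycle:
  assumes "m \<ge> 1"
  shows "pair_wf_digraph (dir_cycle m a)"
  by unfold_locales (auto simp: pverts_dir_cycle[OF assms] parcs_dir_cycle[OF assms])

section \<open>One-regularity as unique neighbours\<close>

text \<open>Arcs are pairs, so the arcs at \<open>v\<close> correspond bijectively to its
  neighbours. A cardinality of 1 already forces a singleton, so no separate finiteness argument
  arises.\<close>

lemma one_regular_iff_ex1: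
  "one_regular D \<longleftrightarrow>
     (\<forall>v \<in> pverts D. (\<exists>!u. (u, v) \<in> parcs D) \<and> (\<exists>!w. (v, w) \<in> parcs D))"
proof -
  have "in_degree (with_proj D) v = 1 \<longleftrightarrow> (\<exists>!u. (u, v) \<in> parcs D)" for v
  proof -
    have "in_arcs (with_proj D) v = (\<lambda>u. (u, v)) ` {u. (u, v) \<in> parcs D}"
      by (auto simp: in_arcs_def)
    then have "in_degree (with_proj D) v = card {u. (u, v) \<in> parcs D}"
      unfolding in_degree_def by (simp add: card_image inj_on_def)
    then show ?thesis by (simp add: card_1_singleton_iff set_eq_iff Ex1_def) (rule ex_cong1, blast)
  qed
  moreover have "out_degree (with_proj D) v = 1 \<longleftrightarrow> (\<exists>!w. (v, w) \<in> parcs D)" for v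
  proof -
    have "out_arcs (with_proj D) v = (\<lambda>w. (v, w)) ` {w. (v, w) \<in> parcs D}"
      by (auto simp: out_arcs_def)
    then have "out_degree (with_proj D) v = card {w. (v, w) \<in> parcs D}"
      unfolding out_degree_def by (simp add: card_image inj_on_def)
    then show ?thesis by (simp add: card_1_singleton_iff set_eq_iff Ex1_def) (rule ex_cong1, blast)
  qed
  ultimately show ?thesis by (simp add: one_regular_def)
qed

lemma one_regular_dir_cycle:
  assumes m: "m \<ge> 1" and inj: "inj_on a {1..m}"
  shows "one_regular (dir_cycle m a)"
  unfolding one_regular_iff_ex1
proof (intro ballI conjI)
  fix v assume "v \<in> pverts (dir_cycle m a)"
  then obtain i where v: "v = cyc m a i"
    by (auto simp: pverts_dir_cycle[OF m])
  \<comment> \<open>Adding \<open>m - 1\<close> is a step back modulo \<open>m\<close> that also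
    works for \<open>i = 0\<close>, where truncated subtraction would fail.\<close>
  have pred: "v = cyc m a (Suc (i + (m - 1)))"
    using m by (simp add: v cyc_def)
  show "\<exists>!u. (u, v) \<in> parcs (dir_cycle m a)"
  proof (rule ex1I)
    show "(cyc m a (i + (m - 1)), v) \<in> parcs (dir_cycle m a)"
      unfolding parcs_dir_cycle[OF m] pred by blast
    fix u assume "(u, v) \<in> parcs (dir_cycle m a)"
    then obtain j where j: "u = cyc m a j" "v = cyc m a (Suc j)"
      unfolding parcs_dir_cycle[OF m] by blast
    then have "Suc j mod m = Suc (i + (m - 1)) mod m"
      using pred cyc_eq_iff[OF m inj] by metis
    then have "j mod m = (i + (m - 1)) mod m"
      by (auto simp: mod_Suc split: if_splits)
    then show "u = cyc m a (i + (m - 1))"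
      using j(1) cyc_eq_iff[OF m inj] by metis
  qed
  show "\<exists>!w. (v, w) \<in> parcs (dir_cycle m a)"
  proof (rule ex1I)
    show "(v, cyc m a (Suc i)) \<in> parcs (dir_cycle m a)"
      unfolding parcs_dir_cycle[OF m] v by blast
    fix w assume "(v, w) \<in> parcs (dir_cycle m a)"
    then obtain j where j: "v = cyc m a j" "w = cyc m a (Suc j)"
      unfolding parcs_dir_cycle[OF m] by blast
    then have "j mod m = i mod m"
      using v cyc_eq_iff[OF m inj] by metis
    then show "w = cyc m a (Suc i)"
      using j(2) cyc_Suc_cong by metis
  qed
qed

section \<open>The product digraph\<close>

lemma pverts_digraph_product: "pverts (digraph_product D V h) = pverts D \<times> V"
  by (simp add: digraph_product_def)

lemma parcs_digraph_product_iff: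
  "((u, x), (v, y)) \<in> parcs (digraph_product D V h) \<longleftrightarrow>
     (u, v) \<in> parcs D \<and> (x, y) \<in> parcs (h (u, v))"
  by (simp add: digraph_product_def)

lemma pair_wf_digraph_product:
  assumes "pair_wf_digraph D"
    and "\<And>e. e \<in> parcs D \<Longrightarrow> pair_wf_digraph (h e) \<and> pverts (h e) = V"
  shows "pair_wf_digraph (digraph_product D V h)"
  using assms unfolding pair_wf_digraph_def
  by (fastforce simp: pverts_digraph_product digraph_product_def)

text \<open>At \<open>(u, x)\<close> the unique arc of \<open>D\<close> into or out of
  \<open>u\<close> fixes the first coordinate of the neighbour. It also selects the digraph
  \<open>h e\<close>, in which the unique arc at \<open>x\<close> fixes the second.\<close>

lemma one_regular_digraph_product:
  assumes "one_regular D"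
    and "\<And>e. e \<in> parcs D \<Longrightarrow> one_regular (h e) \<and> pverts (h e) = V"
  shows "one_regular (digraph_product D V h)"
  unfolding one_regular_iff_ex1
proof
  fix w assume "w \<in> pverts (digraph_product D V h)"
  then obtain u x where w: "w = (u, x)" "u \<in> pverts D" "x \<in> V"
    by (auto simp: pverts_digraph_product)
  have reg: "(\<exists>!y. (y, x) \<in> parcs (h e)) \<and> (\<exists>!y. (x, y) \<in> parcs (h e))" if "e \<in> parcs D" for e
    using assms(2)[OF that] w(3) by (simp add: one_regular_iff_ex1)
  obtain t where t: "(t, u) \<in> parcs D" "\<And>t'. (t', u) \<in> parcs D \<Longrightarrow> t' = t"
    using assms(1) w(2) unfolding one_regular_iff_ex1 by metis
  obtain v where v: "(u, v) \<in> parcs D" "\<And>v'. (u, v') \<in> parcs D \<Longrightarrow> v' = v"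
    using assms(1) w(2) unfolding one_regular_iff_ex1 by metis
  obtain y where y: "(y, x) \<in> parcs (h (t, u))" "\<And>y'. (y', x) \<in> parcs (h (t, u)) \<Longrightarrow> y' = y"
    using reg[OF t(1)] by metis
  obtain z where z: "(x, z) \<in> parcs (h (u, v))" "\<And>z'. (x, z') \<in> parcs (h (u, v)) \<Longrightarrow> z' = z"
    using reg[OF v(1)] by metis
  have "\<exists>!p. (p, w) \<in> parcs (digraph_product D V h)"
  proof (rule ex1I)
    show "((t, y), w) \<in> parcs (digraph_product D V h)"
      unfolding w(1) parcs_digraph_product_iff using t(1) y(1) ..
    fix p assume "(p, w) \<in> parcs (digraph_product D V h)"
    then have "(fst p, u) \<in> parcs D" "(snd p, x) \<in> parcs (h (fst p, u))"
      by (auto simp: w(1) digraph_product_def)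
    then show "p = (t, y)" using t(2) y(2) by (metis prod.collapse)
  qed
  moreover have "\<exists>!p. (w, p) \<in> parcs (digraph_product D V h)"
  proof (rule ex1I)
    show "(w, (v, z)) \<in> parcs (digraph_product D V h)"
      unfolding w(1) parcs_digraph_product_iff using v(1) z(1) ..
    fix p assume "(w, p) \<in> parcs (digraph_product D V h)"
    then have "(u, fst p) \<in> parcs D" "(x, snd p) \<in> parcs (h (u, fst p))"
      by (auto simp: w(1) digraph_product_def)
    then show "p = (v, z)" using v(2) z(2) by (metis prod.collapse)
  qed
  ultimately show "(\<exists>!p. (p, w) \<in> parcs (digraph_product D V h)) \<and>
      (\<exists>!p. (w, p) \<in> parcs (digraph_product D V h))" ..
qed

section \<open>Closed walks, strong connectivity and oriented cycles\<close>

text \<open>From \<open>W i\<close> follow the walk to its end \<open>W N = W 0\<close>, then from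
  the start on to \<open>W j\<close>; every vertex is some \<open>W i\<close>.\<close>

lemma strongly_connected_if_closed_walk:
  fixes W :: "nat \<Rightarrow> 'a"
  assumes wf: "pair_wf_digraph D"
    and arc: "\<And>t. t < N \<Longrightarrow> (W t, W (Suc t)) \<in> parcs D"
    and closed: "W N = W 0"
    and ne: "pverts D \<noteq> {}"
    and cover: "pverts D \<subseteq> W ` {..<N}"
  shows "strongly_connected (with_proj D)"
proof -
  interpret pair_wf_digraph D by (rule wf)
  have reach: "(W i, W j) \<in> (parcs D)\<^sup>*" if "i \<le> j" "j \<le> N" for i j
    using that
  proof (induction j rule: dec_induct)
    case (step n)
    then show ?case by (meson Suc_le_lessD arc less_imp_le rtrancl.rtrancl_into_rtrancl)
  qed simp
  show ?thesis
    unfolding strongly_connected_def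
  proof (intro conjI ballI)
    fix u v assume uv: "u \<in> verts (with_proj D)" "v \<in> verts (with_proj D)"
    then have "u \<in> W ` {..<N}" "v \<in> W ` {..<N}"
      using cover by auto
    then obtain i j where ij: "u = W i" "i < N" "v = W j" "j < N"
      by blast
    have "(u, v) \<in> (parcs D)\<^sup>*"
      using rtrancl_trans[of "W i" "W N" _ "W j"] reach[of i N] reach[of 0 j] ij closed by simp
    then show "u \<rightarrow>\<^sup>*\<^bsub>with_proj D\<^esub> v"
      using uv by (simp add: reachable_conv)
  qed (use ne in simp)
qed

lemma strongly_connected_dir_cycle:
  assumes "m \<ge> 1"
  shows "strongly_connected (with_proj (dir_cycle m a))"
proof (rule strongly_connected_if_closed_walk[where W = "cyc m a" and N = m])
  show "pverts (dir_cycle m a) \<subseteq> cyc m a ` {..<m}"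
  proof
    fix v assume "v \<in> pverts (dir_cycle m a)"
    then obtain i where "v = cyc m a i"
      by (auto simp: pverts_dir_cycle[OF assms])
    then have "v = cyc m a (i mod m)" by (simp add: cyc_def)
    then show "v \<in> cyc m a ` {..<m}" using assms by auto
  qed
  show "(cyc m a t, cyc m a (Suc t)) \<in> parcs (dir_cycle m a)" for t
    unfolding parcs_dir_cycle[OF assms] by blast
qed (use assms in \<open>simp_all add: pair_wf_dir_cycle pverts_dir_cycle cyc_def\<close>)

text \<open>The walk is the orbit of \<open>w0\<close> under the successor map. Strong connectivity
  makes it reach every vertex, counting excludes an early repetition, and in-degree 1 forces the
  first return to be to the start.\<close>

lemma one_regular_strongly_connected_enum:
  assumes wf: "pair_wf_digraph D" and fin: "finite (pverts D)" and reg: "one_regular D"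
    and sc: "strongly_connected (with_proj D)" and w0: "w0 \<in> pverts D"
  obtains W :: "nat \<Rightarrow> 'a" where "W 0 = w0" "\<And>t. (W t, W (Suc t)) \<in> parcs D"
    "bij_betw W {..<card (pverts D)} (pverts D)" "W (card (pverts D)) = W 0"
proof -
  interpret pair_wf_digraph D by (rule wf)
  define F where "F v = (THE w. (v, w) \<in> parcs D)" for v
  define W where "W t = (F ^^ t) w0" for t
  let ?N = "card (pverts D)"
  have F: "(v, w) \<in> parcs D \<longleftrightarrow> w = F v" if "v \<in> pverts D" for v w
    using reg that theI'[of "\<lambda>w. (v, w) \<in> parcs D"] unfolding one_regular_iff_ex1 F_def by metis
  have WS: "W (Suc t) = F (W t)" for t by (simp add: W_def)
  have Wv: "W t \<in> pverts D" for t
  proof (induction t)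
    case 0 then show ?case by (simp add: W_def w0)
  next
    case (Suc t)
    then have "(W t, W (Suc t)) \<in> parcs D" using F WS by blast
    then show ?case using in_arcsD2 by blast
  qed
  have arc: "(W t, W (Suc t)) \<in> parcs D" for t
    using F Wv WS by blast
  have surj: "pverts D \<subseteq> range W"
  proof
    fix v assume "v \<in> pverts D"
    then have "(w0, v) \<in> (parcs D)\<^sup>*"
      using sc w0 unfolding strongly_connected_def by (auto simp: reachable_conv)
    then show "v \<in> range W"
    proof induction
      case base
      have "w0 = W 0" by (simp add: W_def)
      then show ?case by blast
    next
      case (step y z)
      then obtain t where "y = W t" by auto
      then have "z = W (Suc t)" using step(2) F[OF Wv] WS by simp
      then show ?case by blast
    qed
  qed
  have inj: "inj_on W {..<?N}"
  proof (rule linorder_inj_onI')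
    fix i j assume ij: "i \<in> {..<?N}" "j \<in> {..<?N}" "i < j"
    show "W i \<noteq> W j"
    proof
      assume eq: "W i = W j"
      \<comment> \<open>The walk is deterministic, so a repetition at \<open>i < j\<close>
        propagates. Any index \<open>t \<ge> j\<close> can then be lowered to
        \<open>i + (t - j)\<close>, so the first \<open>j\<close> values would be all vertices,
        although \<open>j\<close> is smaller than their number.\<close>
      have shift: "W (i + k) = W (j + k)" for k
        by (induction k) (simp_all add: eq WS)
      have "W t \<in> W ` {..<j}" for t
      proof (induction t rule: less_induct)
        case (less t)
        show ?case
        proof (cases "t < j")
          case False
          then have "W (i + (t - j)) = W t" using shift[of "t - j"] by simp
          moreover have "i + (t - j) < t" using False ij(3) by simp
          ultimately show ?thesis using less by metis
        qed simp
      qed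
      then have "pverts D \<subseteq> W ` {..<j}" using surj by blast
      then have "?N \<le> card (W ` {..<j})" by (intro card_mono) auto
      also have "\<dots> \<le> j" using card_image_le[of "{..<j}" W] by simp
      finally show False using ij(2) by simp
    qed
  qed
  then have bij: "W ` {..<?N} = pverts D"
    using Wv by (intro card_subset_eq fin) (auto simp: card_image)
  then obtain k where k: "k < ?N" "W k = W ?N" using Wv[of ?N] by (metis imageE lessThan_iff)
  \<comment> \<open>Otherwise \<open>W k\<close> has the predecessors \<open>W (k - 1)\<close> and
    \<open>W (?N - 1)\<close>. In-degree 1 identifies them, against injectivity below
    \<open>?N\<close>.\<close>
  have "k = 0"
  proof (rule ccontr)
    assume "k \<noteq> 0"
    then obtain l where l: "k = Suc l" using not0_implies_Suc by blast
    obtain M where M: "?N = Suc M" using k(1) by (cases ?N) auto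
    have "(W l, W k) \<in> parcs D" "(W M, W k) \<in> parcs D"
      using arc[of l] arc[of M] l M k(2) by simp_all
    then have "W l = W M" using reg Wv unfolding one_regular_iff_ex1 by metis
    then have "l = M" using inj_onD[OF inj] k(1) l M by simp
    then show False using k(1) l M by simp
  qed
  then show thesis
    using that[of W] arc inj bij k by (simp add: bij_betw_def W_def)
qed

text \<open>The vertices of the walk are all vertices, and since out-degrees are 1 its arcs are all
  arcs.\<close>

lemma strongly_oriented_cycle_if_enum:
  assumes wf: "pair_wf_digraph D" and reg: "one_regular D" and N: "N \<ge> 1"
    and arc: "\<And>t. (W t, W (Suc t)) \<in> parcs D"
    and bij: "bij_betw W {..<N} (pverts D)" and closed: "W N = W 0"
  shows "strongly_oriented_cycle D N"
proof -
  interpret pair_wf_digraph D by (rule wf)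
  \<comment> \<open>\<open>dir_cycle\<close> numbers its vertices from 1, the walk from 0.\<close>
  define b where "b i = W (i - 1)" for i
  have "bij_betw (\<lambda>i. i - 1) {1..N} {..<N}"
    by (rule bij_betwI[where g = Suc]) auto
  then have "bij_betw (W \<circ> (\<lambda>i. i - 1)) {1..N} (pverts D)"
    using bij by (rule bij_betw_trans)
  then have "inj_on b {1..N}" "pverts D = b ` {1..N}"
    unfolding bij_betw_def b_def comp_def by simp_all
  moreover have "parcs D = parcs (dir_cycle N b)"
  proof (intro equalityI subrelI)
    have b1: "(b i, b (i + 1)) \<in> parcs D" if "1 \<le> i" for i
      using arc[of "i - 1"] that by (simp add: b_def)
    have b2: "(b N, b 1) \<in> parcs D"
      using arc[of "N - 1"] N closed by (simp add: b_def)
    fix u v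
    { assume "(u, v) \<in> parcs (dir_cycle N b)"
      then show "(u, v) \<in> parcs D" using b1 b2 unfolding dir_cycle_def by auto }
    assume uv: "(u, v) \<in> parcs D"
    then have "u \<in> pverts D" using in_arcsD1 by blast
    then obtain i where i: "1 \<le> i" "i \<le> N" "u = b i"
      using \<open>pverts D = b ` {1..N}\<close> by auto
    have uniq: "v = w" if "(u, w) \<in> parcs D" for w
      using reg uv that \<open>u \<in> pverts D\<close> unfolding one_regular_iff_ex1 by metis
    show "(u, v) \<in> parcs (dir_cycle N b)"
    proof (cases "i = N")
      case True
      then show ?thesis using uniq b2 i unfolding dir_cycle_def by auto
    next
      case False
      then show ?thesis using uniq b1[of i] i unfolding dir_cycle_def by auto
    qed
  qed
  ultimately show ?thesis
    using N unfolding strongly_oriented_cycle_def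
    by (intro conjI exI[of _ b]) (auto simp: dir_cycle_def)
qed

section \<open>Indexed walks in multidigraphs and repeated color sequences\<close>

context pre_digraph
begin

text \<open>Appending an arc splits \<open>cas\<close> at the last vertex of the prefix, so the
  claim on \<open>awlast\<close> is carried along to make the induction work.\<close>

lemma cas_map_upt:
  assumes "\<And>t. t < N \<Longrightarrow> tail G (E t) = X t \<and> head G (E t) = X (Suc t)"
  shows "cas (X 0) (map E [0..<N]) (X N) \<and> awlast (X 0) (map E [0..<N]) = X N"
  using assms by (induction N) (auto simp: awalk_verts_conv)

text \<open>Converts a walk given as a list of arcs into an indexed vertex sequence whose
  consecutive entries are the ends of the arcs.\<close>

lemma cas_nth:
  assumes "cas u p v"
  shows "awalk_verts u p ! 0 = u" "awalk_verts u p ! length p = v"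
    "t < length p \<Longrightarrow> tail G (p ! t) = awalk_verts u p ! t"
    "t < length p \<Longrightarrow> head G (p ! t) = awalk_verts u p ! Suc t"
proof -
  have hd: "awalk_verts x q ! 0 = x" if "cas x q y" for x y q
    using that by (cases q) auto
  show "awalk_verts u p ! 0 = u" using assms by (rule hd)
  show "awalk_verts u p ! length p = v"
    using assms by (induction p arbitrary: u) auto
  show "t < length p \<Longrightarrow> tail G (p ! t) = awalk_verts u p ! t"
    using assms by (induction p arbitrary: u t) (auto simp: nth_Cons split: nat.split)
  show "t < length p \<Longrightarrow> head G (p ! t) = awalk_verts u p ! Suc t"
    using assms by (induction p arbitrary: u t) (auto simp: nth_Cons hd split: nat.split)
qed

end

text \<open>Lets the color at position \<open>t\<close> of a repeated sequence be read off from
  \<open>t mod m\<close>.\<close>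

lemma concat_replicate_map_upt:
  "concat (replicate k (map f [0..<m])) = map (\<lambda>t. f (t mod m)) [0..<k * m]"
proof (induction k)
  case (Suc k)
  have "[0..<Suc k * m] = [0..<m] @ map (\<lambda>t. t + m) [0..<k * m]"
    by (simp add: map_add_upt upt_add_eq_append[of 0 m "k * m", simplified] add.commute)
  then show ?case by (simp add: Suc)
qed simp

lemma union_multidigraph_simps:
  "verts (union_multidigraph D V h) = V"
  "(e, (x, y)) \<in> arcs (union_multidigraph D V h) \<longleftrightarrow> e \<in> parcs D \<and> (x, y) \<in> parcs (h e)"
  "tail (union_multidigraph D V h) (e, (x, y)) = x"
  "head (union_multidigraph D V h) (e, (x, y)) = y"
  by (cases e; auto simp: union_multidigraph_def)+

section \<open>From walks in the product to rainbow circuits and back\<close>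

text \<open>Each arc of the product projects to an arc of the cycle, and a vertex of the cycle has
  only one outgoing arc, so the projection advances by one position per step.\<close>

lemma fst_walk_digraph_product_dir_cycle:
  assumes m: "m \<ge> 1" and inj: "inj_on a {1..m}"
    and start: "fst (W 0) = cyc m a 0"
    and arc: "\<And>t. (W t, W (Suc t)) \<in> parcs (digraph_product (dir_cycle m a) V h)"
  shows "fst (W t) = cyc m a t"
proof (induction t)
  case (Suc t)
  have "(fst (W t), fst (W (Suc t))) \<in> parcs (dir_cycle m a)"
    using arc[of t] by (auto simp: digraph_product_def)
  then obtain j where j: "fst (W t) = cyc m a j" "fst (W (Suc t)) = cyc m a (Suc j)"
    unfolding parcs_dir_cycle[OF m] by blast
  then have "j mod m = t mod m" using Suc cyc_eq_iff[OF m inj] by metis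
  then show ?case using j(2) cyc_Suc_cong by metis
qed (rule start)

text \<open>Reading each arc of the closed walk as an arc of the multidigraph gives a closed trail,
  and \<open>n\<close> turns around the cycle give \<open>n\<close> copies of the color
  sequence.\<close>

lemma rainbow_eulerian_if_enum:
  fixes m :: nat and a :: "nat \<Rightarrow> 'a" and V :: "'v set" and h :: "'a \<times> 'a \<Rightarrow> 'v pair_pre_digraph"
  defines "P \<equiv> digraph_product (dir_cycle m a) V h"
  assumes m: "m \<ge> 1" and inj: "inj_on a {1..m}"
    and wf: "pair_wf_digraph P" and reg: "one_regular P"
    and wfh: "\<And>e. e \<in> parcs (dir_cycle m a) \<Longrightarrow> pair_wf_digraph (h e) \<and> pverts (h e) = V"
    and col: "\<And>i. col (cyc m a i, cyc m a (Suc i)) = s (Suc (i mod m))"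
    and start: "fst (W 0) = cyc m a 0"
    and arc: "\<And>t. (W t, W (Suc t)) \<in> parcs P"
    and bij: "bij_betw W {..<n * m} (pverts P)" and closed: "W (n * m) = W 0"
  shows "rainbow_eulerian (union_multidigraph (dir_cycle m a) V h)
           (induced_coloring col) (map s [1..<m + 1])"
proof -
  let ?G = "union_multidigraph (dir_cycle m a) V h"
  interpret P: pair_wf_digraph P by (rule wf)
  interpret G: pre_digraph ?G .
  define E where "E t = ((fst (W t), fst (W (Suc t))), (snd (W t), snd (W (Suc t))))" for t
  define X where "X t = snd (W t)" for t
  let ?p = "map E [0..<n * m]"
  \<comment> \<open>The arc \<open>E t\<close> determines its starting vertex \<open>W t\<close> in
    the product, so \<open>E\<close> inherits injectivity from \<open>W\<close> and no arc is used
    twice.\<close>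
  have W_eq: "W t = (fst (fst (E t)), fst (snd (E t)))" for t by (simp add: E_def)
  have ends: "tail ?G (E t) = X t" "head ?G (E t) = X (Suc t)" for t
    by (simp_all add: E_def X_def union_multidigraph_simps)
  have fstW: "fst (W t) = cyc m a t" for t
    using fst_walk_digraph_product_dir_cycle[of m a W, OF m inj start arc[unfolded P_def]] .
  have E_arc: "E t \<in> arcs ?G" for t
    using arc[of t] unfolding P_def E_def union_multidigraph_simps
    by (auto simp: digraph_product_def)
  have WP: "W t \<in> pverts P" for t using arc P.in_arcsD1 by blast
  have W_cover: "\<exists>t < n * m. w = W t" if "w \<in> pverts P" for w
    using bij that unfolding bij_betw_def by blast
  have "distinct ?p"
  proof -
    have "inj_on E {..<n * m}"
      using bij W_eq unfolding bij_betw_def inj_on_def by metis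
    then show ?thesis by (simp add: distinct_map atLeast_upt)
  qed
  moreover have "set ?p = arcs ?G"
  proof (intro equalityI subsetI)
    fix f assume f: "f \<in> arcs ?G"
    obtain c d x y where f_eq: "f = ((c, d), (x, y))" by (metis surj_pair)
    have cx: "((c, x), (d, y)) \<in> parcs P"
      using f unfolding f_eq union_multidigraph_simps P_def parcs_digraph_product_iff .
    then obtain t where t: "t < n * m" "(c, x) = W t" using W_cover P.in_arcsD1 by metis
    \<comment> \<open>The walk passes through \<open>(c, x)\<close> and must leave it by its only
      outgoing arc, so every arc of the multidigraph is used.\<close>
    then have "(d, y) = W (Suc t)"
      using cx arc[of t] WP[of t] reg unfolding one_regular_iff_ex1 by metis
    then have "f = E t"
      unfolding E_def f_eq using t(2) by (metis fst_conv snd_conv)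
    then show "f \<in> set ?p" using t(1) by simp
  qed (use E_arc in auto)
  moreover have "X t \<in> V" for t
    using WP[of t] by (auto simp: X_def P_def pverts_digraph_product)
  moreover have "set (G.awalk_verts (X 0) ?p) = V"
  proof (intro equalityI subsetI)
    fix x assume "x \<in> set (G.awalk_verts (X 0) ?p)"
    then show "x \<in> V"
      using \<open>\<And>t. X t \<in> V\<close> by (auto simp: G.awalk_verts_conv ends last_map split: if_splits)
  next
    fix x assume "x \<in> V"
    \<comment> \<open>Any lift of \<open>x\<close> to the product would do; the one above the first
      cycle vertex is taken, and the walk visits it.\<close>
    then have "(cyc m a 0, x) \<in> pverts P"
      by (simp add: P_def pverts_digraph_product pverts_dir_cycle[OF m])
    then obtain t where "t < n * m" "W t = (cyc m a 0, x)" using W_cover by metis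
    then have "E t \<in> set ?p" "tail ?G (E t) = x" by (simp_all add: ends X_def)
    then show "x \<in> set (G.awalk_verts (X 0) ?p)"
      by (auto simp: G.awalk_verts_conv)
  qed
  moreover have "G.cas (X 0) ?p (X 0)"
    using G.cas_map_upt[of "n * m" E X] ends closed by (simp add: X_def)
  moreover have "map (induced_coloring col) ?p = concat (replicate n (map s [1..<m + 1]))"
  proof -
    have "map s [1..<m + 1] = map (\<lambda>i. s (Suc i)) [0..<m]"
      by (simp add: map_Suc_upt[symmetric] del: upt_Suc)
    then show ?thesis
      by (simp add: concat_replicate_map_upt induced_coloring_def E_def fstW col del: upt_Suc)
  qed
  ultimately have "G.euler_trail (X 0) ?p (X 0)"
    "rainbow_circuit ?G (induced_coloring col) (map s [1..<m + 1]) (X 0) ?p"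
    unfolding rainbow_circuit_def G.euler_trail_def G.trail_def G.awalk_def
    by (auto simp: union_multidigraph_simps simp del: set_map map_map)
  then show ?thesis unfolding rainbow_eulerian_def by blast
qed

text \<open>Adjoining to each vertex of the circuit its position on the cycle lifts the circuit to a
  closed walk in the product. As the colors are distinct, the color at time \<open>t\<close> forces
  the arc to come from position \<open>t\<close> of the cycle.\<close>

lemma strongly_connected_if_rainbow_eulerian:
  fixes m :: nat and a :: "nat \<Rightarrow> 'a" and V :: "'v set" and h :: "'a \<times> 'a \<Rightarrow> 'v pair_pre_digraph"
  defines "P \<equiv> digraph_product (dir_cycle m a) V h"
  assumes m: "m \<ge> 1" and inj_s: "inj_on s {1..m}"
    and wf: "pair_wf_digraph P" and reg: "one_regular P"
    and col: "\<And>i. col (cyc m a i, cyc m a (Suc i)) = s (Suc (i mod m))"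
    and re: "rainbow_eulerian (union_multidigraph (dir_cycle m a) V h)
               (induced_coloring col) (map s [1..<m + 1])"
  shows "strongly_connected (with_proj P)"
proof -
  let ?G = "union_multidigraph (dir_cycle m a) V h"
  interpret P: pair_wf_digraph P by (rule wf)
  interpret G: pre_digraph ?G .
  obtain u p k where p: "G.euler_trail u p u"
      "map (induced_coloring col) p = concat (replicate k (map s [1..<m + 1]))"
    using re unfolding rainbow_eulerian_def rainbow_circuit_def by blast
  then have u: "u \<in> V" and cas: "G.cas u p u" and arcs: "set p = arcs ?G"
    unfolding G.euler_trail_def G.trail_def G.awalk_def by (simp_all add: union_multidigraph_simps)
  define Y where "Y t = G.awalk_verts u p ! t" for t
  define W where "W t = (cyc m a t, Y t)" for t
  have "map s [1..<m + 1] = map (\<lambda>i. s (Suc i)) [0..<m]"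
    by (simp add: map_Suc_upt[symmetric] del: upt_Suc)
  then have colors: "map (induced_coloring col) p = map (\<lambda>t. s (Suc (t mod m))) [0..<k * m]"
    using p(2) by (simp only: concat_replicate_map_upt)
  then have len: "length p = k * m"
    by (metis diff_zero length_map length_upt)
  have nth: "p ! t = ((cyc m a t, cyc m a (Suc t)), (Y t, Y (Suc t)))" if t: "t < length p" for t
  proof -
    obtain e x y where pt: "p ! t = (e, (x, y))" by (metis surj_pair)
    have "e \<in> parcs (dir_cycle m a)"
      using nth_mem[OF t] unfolding pt arcs union_multidigraph_simps by blast
    then obtain j where j: "e = (cyc m a j, cyc m a (Suc j))"
      unfolding parcs_dir_cycle[OF m] by blast
    have "induced_coloring col (p ! t) = s (Suc (t mod m))"
      using arg_cong[OF colors, of "\<lambda>l. l ! t"] t len by simp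
    \<comment> \<open>The color computed from the cycle arc underlying \<open>p ! t\<close> is
      compared with the color prescribed at time \<open>t\<close>; injectivity of \<open>s\<close>
      then gives equal residues.\<close>
    then have "s (Suc (j mod m)) = s (Suc (t mod m))"
      by (simp add: pt j col induced_coloring_def)
    moreover have "Suc (i mod m) \<in> {1..m}" for i using m by (simp add: Suc_le_eq)
    ultimately have "j mod m = t mod m"
      using inj_onD[OF inj_s] by blast
    then have "e = (cyc m a t, cyc m a (Suc t))"
      using j cyc_Suc_cong by (metis cyc_def)
    then show ?thesis
      using G.cas_nth(3,4)[OF cas t] by (simp add: pt union_multidigraph_simps Y_def)
  qed
  show ?thesis
  proof (rule strongly_connected_if_closed_walk[OF wf])
    fix t assume t: "t < length p"
    show "(W t, W (Suc t)) \<in> parcs P"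
      using nth_mem[OF t] unfolding nth[OF t] arcs union_multidigraph_simps
        W_def P_def parcs_digraph_product_iff .
  next
    \<comment> \<open>The second coordinate closes because \<open>p\<close> is a circuit, the first
      because its length is a multiple of \<open>m\<close>.\<close>
    show "W (length p) = W 0"
      using G.cas_nth(1,2)[OF cas] by (simp add: W_def Y_def cyc_def len)
  next
    show "pverts P \<noteq> {}"
      using u by (auto simp: P_def pverts_digraph_product pverts_dir_cycle[OF m])
  next
    show "pverts P \<subseteq> W ` {..<length p}"
    proof
      fix w assume w: "w \<in> pverts P"
      \<comment> \<open>An outgoing arc of \<open>w\<close> has its copy in the multidigraph on the
        eulerian circuit, so the lifted walk passes through \<open>w\<close>.\<close>
      then obtain w' where w': "(w, w') \<in> parcs P"
        using reg unfolding one_regular_iff_ex1 by blast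
      obtain c x d y where eq: "w = (c, x)" "w' = (d, y)" by (metis surj_pair)
      have "((c, d), (x, y)) \<in> set p"
        using w' unfolding eq P_def parcs_digraph_product_iff arcs union_multidigraph_simps .
      then obtain t where t: "t < length p" "p ! t = ((c, d), (x, y))"
        by (meson in_set_conv_nth)
      then have "w = W t" using nth[OF t(1)] by (simp add: eq W_def)
      then show "w \<in> W ` {..<length p}" using t(1) by blast
    qed
  qed
qed

theorem theorem2p1:
  fixes m :: nat
    and a :: "nat \<Rightarrow> 'a"
    and V :: "'v set"
    and \<Gamma> :: "'v pair_pre_digraph set"
    and h :: "'a \<times> 'a \<Rightarrow> 'v pair_pre_digraph"
    and s :: "nat \<Rightarrow> 'c"
    and col :: "'a \<times> 'a \<Rightarrow> 'c"
  assumes "m \<ge> 1"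
    and "inj_on a {1..m}"
    and "finite V"
    and "\<And>D. D \<in> \<Gamma> \<Longrightarrow> pair_wf_digraph D \<and> pverts D = V \<and> one_regular D"
    and "\<And>e. e \<in> parcs (dir_cycle m a) \<Longrightarrow> h e \<in> \<Gamma>"
    and "inj_on s {1..m}"
    and "\<And>i. 1 \<le> i \<Longrightarrow> i \<le> m - 1 \<Longrightarrow> col (a i, a (i + 1)) = s i"
    and "col (a m, a 1) = s m"
  shows "(strongly_connected (with_proj (digraph_product (dir_cycle m a) V h))
            \<longleftrightarrow> rainbow_eulerian (union_multidigraph (dir_cycle m a) V h)
                  (induced_coloring col) (map s [1..<m + 1]))
       \<and> (strongly_connected (with_proj (digraph_product (dir_cycle m a) V h))
            \<longleftrightarrow> strongly_oriented_cycle (digraph_product (dir_cycle m a) V h) (m * card V))"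
proof -
  note m = assms(1) and inj = assms(2)
  let ?C = "dir_cycle m a"
  let ?P = "digraph_product ?C V h"
  have H: "pair_wf_digraph (h e)" "pverts (h e) = V" "one_regular (h e)"
    if "e \<in> parcs ?C" for e
    using assms(4,5) that by blast+
  have wf: "pair_wf_digraph ?P"
    using H by (intro pair_wf_digraph_product pair_wf_dir_cycle m) blast
  have reg: "one_regular ?P"
    using H by (intro one_regular_digraph_product one_regular_dir_cycle m inj) blast
  have fin: "finite (pverts ?P)"
    using assms(3) by (simp add: pverts_digraph_product finite_pverts_dir_cycle)
  have card: "card (pverts ?P) = m * card V"
    using inj by (simp add: pverts_digraph_product card_cartesian_product card_pverts_dir_cycle)
  \<comment> \<open>The two coloring assumptions merge into one periodic rule; the first case is the
    closing arc.\<close>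
  have col: "col (cyc m a i, cyc m a (Suc i)) = s (Suc (i mod m))" for i
  proof (cases "Suc (i mod m) = m")
    case True
    then show ?thesis using assms(8) by (simp add: cyc_def mod_Suc)
  next
    case False
    moreover have "i mod m < m" using m by simp
    ultimately have "Suc (i mod m) \<le> m - 1" by linarith
    then show ?thesis using assms(7)[of "Suc (i mod m)"] False by (simp add: cyc_def mod_Suc)
  qed
  have "rainbow_eulerian (union_multidigraph ?C V h) (induced_coloring col) (map s [1..<m + 1])
      \<and> strongly_oriented_cycle ?P (m * card V)"
    if sc: "strongly_connected (with_proj ?P)"
  proof -
    \<comment> \<open>Strong connectivity includes nonemptiness. This excludes an empty
      \<open>V\<close> and supplies a starting vertex above \<open>a 1\<close>.\<close>
    have "pverts ?P \<noteq> {}" using sc by (simp add: strongly_connected_def)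
    then obtain x where "x \<in> V" by (auto simp: pverts_digraph_product)
    then have start: "(cyc m a 0, x) \<in> pverts ?P"
      by (simp add: pverts_digraph_product pverts_dir_cycle[OF m])
    obtain W where W: "W 0 = (cyc m a 0, x)" "\<And>t. (W t, W (Suc t)) \<in> parcs ?P"
        "bij_betw W {..<m * card V} (pverts ?P)" "W (m * card V) = W 0"
      using one_regular_strongly_connected_enum[OF wf fin reg sc start] unfolding card by metis
    have "m * card V \<ge> 1"
      using start fin card by (metis One_nat_def Suc_le_eq card_gt_0_iff empty_iff)
    then have "strongly_oriented_cycle ?P (m * card V)"
      using strongly_oriented_cycle_if_enum[OF wf reg] W(2-4) by blast
    moreover have "rainbow_eulerian (union_multidigraph ?C V h) (induced_coloring col) (map s [1..<m + 1])"
      by (rule rainbow_eulerian_if_enum[OF m inj wf reg, where W = W and n = "card V"])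
        (use H col W in \<open>simp_all add: mult.commute\<close>)
    ultimately show ?thesis by blast
  qed
  moreover have "strongly_connected (with_proj ?P)"
    if "rainbow_eulerian (union_multidigraph ?C V h) (induced_coloring col) (map s [1..<m + 1])"
    using strongly_connected_if_rainbow_eulerian[OF m assms(6) wf reg] col that by blast
  moreover have "strongly_connected (with_proj ?P)"
    if "strongly_oriented_cycle ?P (m * card V)"
    using that strongly_connected_dir_cycle unfolding strongly_oriented_cycle_def by metis
  ultimately show ?thesis by blast
qed

end
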